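(* The backward Euler post-processed VMS-POD approximation (Steps 1 and 2 in the context) is unconditionally stable in the following sense: for any $\Delta t>0$, $$\|\mathbf u_r^M\|^2+\sum_{n=0}^{M-1}\Big[2\nu_T\Delta t\Big\|(I-P_R)\nabla\frac{\mathbf w_r^{n+1}+\mathbf u_r^{n+1}}2\Big\|^2+\|\mathbf w_r^{n+1}-\mathbf u_r^n\|^2+\nu\Delta t\|\nabla\mathbf w_r^{n+1}\|^2\Big]\le\|\mathbf u_r^0\|^2+\nu^{-1}|||\mathbf f|||_{2,-1}^2 .$$
   Context: $\Omega\subset\mathbb R^{\ell}$, $\ell\in\{2,3\}$, is a polygonal/polyhedral domain; $\|\cdot\|$, $(\cdot,\cdot)$ are the $L^2(\Omega)$ norm and inner product (for scalar, vector or matrix fields), $\mathbf X=(H_0^1(\Omega))^{\ell}$, and $\|\mathbf f\|_{-1}=\sup_{\mathbf v\in\mathbf X}|(\mathbf f,\mathbf v)|/\|\nabla\mathbf v\|$. $\nu>0$ is the kinematic viscosity and $\mathbf f\in L^2(0,T;H^{-1}(\Omega))$ the forcing (pointwise values $\mathbf f^n=\mathbf f(t^n)$, $t^n=n\Delta t$, are assumed meaningful), with $\Delta t=T/M$ and $|||\mathbf f|||_{2,-1}=\big(\Delta t\sum_{n=0}^M\|\mathbf f^n\|_{-1}^2\big)^{1/2}$. The skew-symmetric convective form is $b(\mathbf u,\mathbf v,\mathbf w)=\frac12\big(((\mathbf u\cdot\nabla)\mathbf v,\mathbf w)-((\mathbf u\cdot\nabla)\mathbf w,\mathbf v)\big)$.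 POD spaces: $\boldsymbol\psi_1,\dots,\boldsymbol\psi_r\in\mathbf X$ are $L^2$-orthonormal POD basis functions (obtained from finite element snapshots of a Navier-Stokes solution lying in a conforming finite element space $\mathbf X^h\subset\mathbf X$), $R<r$, $\mathbf X^r=\mathrm{span}\{\boldsymbol\psi_1,\dots,\boldsymbol\psi_r\}$, $\mathbf L^R=\mathrm{span}\{\nabla\boldsymbol\psi_1,\dots,\nabla\boldsymbol\psi_R\}$, and $P_R$ is the $L^2$-orthogonal projection onto $\mathbf L^R$. $\nu_T>0$ is a given constant (eddy viscosity). Algorithm: $\mathbf u_r^0=\mathbf w_r^0$ is the $L^2$ projection of the initial velocity $\mathbf u_0$ onto $\mathbf X^r$. For $n=0,1,\dots,M-1$, given $\mathbf u_r^n\in\mathbf X^r$: Step 1: find $\mathbf w_r^{n+1}\in\mathbf X^r$ with $\big(\frac{\mathbf w_r^{n+1}-\mathbf u_r^n}{\Delta t},\boldsymbol\psi\big)+b(\mathbf w_r^{n+1},\mathbf w_r^{n+1},\boldsymbol\psi)+\nu(\nabla\mathbf w_r^{n+1},\nabla\boldsymbol\psi)=(\mathbf f^{n+1},\boldsymbol\psi)$ for all $\boldsymbol\psi\in\mathbf X^r$. Step 2: find $\mathbf u_r^{n+1}\in\mathbf X^r$ with $\big(\frac{\mathbf w_r^{n+1}-\mathbf u_r^{n+1}}{\Delta t},\boldsymbol\psi\big)=\big(\nu_T(I-P_R)\nabla\frac{\mathbf w_r^{n+1}+\mathbf u_r^{n+1}}2,(I-P_R)\nabla\boldsymbol\psi\big)$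 for all $\boldsymbol\psi\in\mathbf X^r$. *)

theory Defs
  imports "HOL-Analysis.Analysis"
begin

section \<open>Domains\<close>

text \<open>Nonempty bounded open connected sets whose boundary is a finite union of
  polytopes of codimension one (edges in the plane, faces in space).\<close>

definition polyhedral_domain :: "(real ^ 'n) set \<Rightarrow> bool" where
  "polyhedral_domain \<Omega> \<longleftrightarrow>
     \<Omega> \<noteq> {} \<and> open \<Omega> \<and> connected \<Omega> \<and> bounded \<Omega> \<and>
     (\<exists>\<F>. finite \<F> \<and> (\<forall>F\<in>\<F>. polytope F \<and> aff_dim F = int CARD('n) - 1) \<and>
          frontier \<Omega> = \<Union>\<F>)"


section \<open>Square integrable fields\<close>

text \<open>Fields are represented by functions; elements of \<open>L\<^sup>2(\<Omega>)\<close> are these functions modulo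
  equality almost everywhere in \<open>\<Omega>\<close>, and only values in \<open>\<Omega>\<close> matter. All subspaces below are
  closed under almost everywhere equality. On matrices \<open>\<bullet>\<close> is the Frobenius inner product.\<close>

definition l2_inner ::
    "'a::euclidean_space set \<Rightarrow> ('a \<Rightarrow> 'b::euclidean_space) \<Rightarrow> ('a \<Rightarrow> 'b) \<Rightarrow> real" where
  "l2_inner \<Omega> f g = (LINT x|lebesgue_on \<Omega>. f x \<bullet> g x)"

definition l2_norm :: "'a::euclidean_space set \<Rightarrow> ('a \<Rightarrow> 'b::euclidean_space) \<Rightarrow> real" where
  "l2_norm \<Omega> f = sqrt (l2_inner \<Omega> f f)"

definition L2 :: "'a::euclidean_space set \<Rightarrow> ('a \<Rightarrow> 'b::euclidean_space) set" where
  "L2 \<Omega> = {f. f \<in> borel_measurable (lebesgue_on \<Omega>) \<and>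
               integrable (lebesgue_on \<Omega>) (\<lambda>x. (norm (f x))\<^sup>2)}"

definition l2_span ::
    "'a::euclidean_space set \<Rightarrow> nat \<Rightarrow> (nat \<Rightarrow> 'a \<Rightarrow> 'b::euclidean_space) \<Rightarrow> ('a \<Rightarrow> 'b) set" where
  "l2_span \<Omega> d \<phi> =
     {v. \<exists>c. AE x in lebesgue_on \<Omega>. v x = (\<Sum>i = 1..d. c i *\<^sub>R \<phi> i x)}"

definition is_l2_proj ::
    "'a::euclidean_space set \<Rightarrow> ('a \<Rightarrow> 'b::euclidean_space) set \<Rightarrow> ('a \<Rightarrow> 'b) \<Rightarrow> ('a \<Rightarrow> 'b) \<Rightarrow> bool"
  where
  "is_l2_proj \<Omega> V g p \<longleftrightarrow> p \<in> V \<and> (\<forall>v\<in>V. l2_inner \<Omega> (\<lambda>x. g x - p x) v = 0)"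

text \<open>A representative of the projection, which is unique up to almost everywhere equality.\<close>

definition l2_proj ::
    "'a::euclidean_space set \<Rightarrow> ('a \<Rightarrow> 'b::euclidean_space) set \<Rightarrow> ('a \<Rightarrow> 'b) \<Rightarrow> ('a \<Rightarrow> 'b)" where
  "l2_proj \<Omega> V g = (SOME p. is_l2_proj \<Omega> V g p)"

definition l2_orthonormal ::
    "'a::euclidean_space set \<Rightarrow> nat \<Rightarrow> (nat \<Rightarrow> 'a \<Rightarrow> 'b::euclidean_space) \<Rightarrow> bool" where
  "l2_orthonormal \<Omega> d \<phi> \<longleftrightarrow>
     (\<forall>i\<in>{1..d}. \<phi> i \<in> L2 \<Omega>) \<and>
     (\<forall>i\<in>{1..d}. \<forall>j\<in>{1..d}. l2_inner \<Omega> (\<phi> i) (\<phi> j) = (if i = j then 1 else 0))"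


section \<open>The space \<open>(H\<^sub>0\<^sup>1(\<Omega>))\<^sup>\<ell>\<close>\<close>

primrec continuously_diff :: "nat \<Rightarrow> ('a::euclidean_space \<Rightarrow> real) \<Rightarrow> bool" where
  "continuously_diff 0 f \<longleftrightarrow> continuous_on UNIV f"
| "continuously_diff (Suc k) f \<longleftrightarrow>
     (\<forall>x. f differentiable (at x)) \<and>
     (\<forall>e\<in>Basis. continuously_diff k (\<lambda>x. frechet_derivative f (at x) e))"

definition test_functions :: "'a::euclidean_space set \<Rightarrow> ('a \<Rightarrow> real) set" where
  "test_functions \<Omega> =
     {\<phi>. (\<forall>k. continuously_diff k \<phi>) \<and>
          compact (closure {x. \<phi> x \<noteq> 0}) \<and> closure {x. \<phi> x \<noteq> 0} \<subseteq> \<Omega>}"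

definition classical_gradient :: "(real ^ 'n \<Rightarrow> real) \<Rightarrow> real ^ 'n \<Rightarrow> real ^ 'n" where
  "classical_gradient \<phi> x = (\<chi> j. frechet_derivative \<phi> (at x) (axis j 1))"

definition is_weak_gradient ::
    "(real ^ 'n) set \<Rightarrow> (real ^ 'n \<Rightarrow> real) \<Rightarrow> (real ^ 'n \<Rightarrow> real ^ 'n) \<Rightarrow> bool" where
  "is_weak_gradient \<Omega> v G \<longleftrightarrow>
     G \<in> L2 \<Omega> \<and>
     (\<forall>\<phi>\<in>test_functions \<Omega>. \<forall>j.
        (LINT x|lebesgue_on \<Omega>. v x * classical_gradient \<phi> x $ j) =
        - (LINT x|lebesgue_on \<Omega>. G x $ j * \<phi> x))"

text \<open>The closure of the test functions in the \<open>H\<^sup>1\<close> norm.\<close>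

definition H10 :: "(real ^ 'n) set \<Rightarrow> (real ^ 'n \<Rightarrow> real) set" where
  "H10 \<Omega> = {v \<in> L2 \<Omega>. \<exists>G. is_weak_gradient \<Omega> v G \<and>
     (\<exists>\<phi>. (\<forall>k::nat. \<phi> k \<in> test_functions \<Omega>) \<and>
          (\<lambda>k. l2_norm \<Omega> (\<lambda>x. v x - \<phi> k x)) \<longlonglongrightarrow> 0 \<and>
          (\<lambda>k. l2_norm \<Omega> (\<lambda>x. G x - classical_gradient (\<phi> k) x)) \<longlonglongrightarrow> 0)}"

text \<open>A representative of the weak gradient, which is unique up to almost everywhere equality.\<close>

definition weak_gradient ::
    "(real ^ 'n) set \<Rightarrow> (real ^ 'n \<Rightarrow> real) \<Rightarrow> real ^ 'n \<Rightarrow> real ^ 'n" where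
  "weak_gradient \<Omega> v = (SOME G. is_weak_gradient \<Omega> v G)"

definition velocity_space :: "(real ^ 'n) set \<Rightarrow> (real ^ 'n \<Rightarrow> real ^ 'n) set" where
  "velocity_space \<Omega> = {v. \<forall>i. (\<lambda>x. v x $ i) \<in> H10 \<Omega>}"

text \<open>Row \<open>i\<close> is the gradient of the component \<open>v\<^sub>i\<close>, so that \<open>(u \<cdot> \<nabla>) v = (\<nabla> v) u\<close>.\<close>

definition grad ::
    "(real ^ 'n) set \<Rightarrow> (real ^ 'n \<Rightarrow> real ^ 'n) \<Rightarrow> real ^ 'n \<Rightarrow> real ^ 'n ^ 'n" where
  "grad \<Omega> v x = (\<chi> i. weak_gradient \<Omega> (\<lambda>y. v y $ i) x)"

definition convection ::
    "(real ^ 'n) set \<Rightarrow> (real ^ 'n \<Rightarrow> real ^ 'n) \<Rightarrow> (real ^ 'n \<Rightarrow> real ^ 'n) \<Rightarrow>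
     real ^ 'n \<Rightarrow> real ^ 'n" where
  "convection \<Omega> u v x = grad \<Omega> v x *v u x"

definition trilinear_b ::
    "(real ^ 'n) set \<Rightarrow> (real ^ 'n \<Rightarrow> real ^ 'n) \<Rightarrow> (real ^ 'n \<Rightarrow> real ^ 'n) \<Rightarrow>
     (real ^ 'n \<Rightarrow> real ^ 'n) \<Rightarrow> real" where
  "trilinear_b \<Omega> u v w =
     1/2 * (l2_inner \<Omega> (convection \<Omega> u v) w - l2_inner \<Omega> (convection \<Omega> u w) v)"


section \<open>The dual space \<open>H\<^sup>-\<^sup>1(\<Omega>)\<close> and time dependent forcing\<close>

text \<open>Functionals are only relevant on \<^term>\<open>velocity_space \<Omega>\<close>; boundedness forces them to
  respect almost everywhere equality.\<close>

definition Hminus1 :: "(real ^ 'n) set \<Rightarrow> ((real ^ 'n \<Rightarrow> real ^ 'n) \<Rightarrow> real) set" where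
  "Hminus1 \<Omega> =
     {F. (\<forall>u\<in>velocity_space \<Omega>. \<forall>v\<in>velocity_space \<Omega>. \<forall>a b.
            F (\<lambda>x. a *\<^sub>R u x + b *\<^sub>R v x) = a * F u + b * F v) \<and>
         (\<exists>C. \<forall>v\<in>velocity_space \<Omega>. \<bar>F v\<bar> \<le> C * l2_norm \<Omega> (grad \<Omega> v))}"

text \<open>For \<open>v = 0\<close> the quotient is \<open>0 / 0 = 0\<close> and does not affect the supremum.\<close>

definition Hminus1_norm ::
    "(real ^ 'n) set \<Rightarrow> ((real ^ 'n \<Rightarrow> real ^ 'n) \<Rightarrow> real) \<Rightarrow> real" where
  "Hminus1_norm \<Omega> F = (SUP v\<in>velocity_space \<Omega>. \<bar>F v\<bar> / l2_norm \<Omega> (grad \<Omega> v))"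

text \<open>\<open>L\<^sup>2(0,T;H\<^sup>-\<^sup>1(\<Omega>))\<close> in the sense of Bochner: strongly measurable and square integrable.\<close>

definition L2_Hminus1 ::
    "(real ^ 'n) set \<Rightarrow> real \<Rightarrow> (real \<Rightarrow> (real ^ 'n \<Rightarrow> real ^ 'n) \<Rightarrow> real) set" where
  "L2_Hminus1 \<Omega> T =
     {f. (AE t in lebesgue_on {0<..<T}. f t \<in> Hminus1 \<Omega>) \<and>
         (\<exists>s. (\<forall>k::nat. simple_function (lebesgue_on {0<..<T}) (s k) \<and>
                        (\<forall>t\<in>{0<..<T}. s k t \<in> Hminus1 \<Omega>)) \<and>
              (AE t in lebesgue_on {0<..<T}.
                 (\<lambda>k. Hminus1_norm \<Omega> (\<lambda>v. f t v - s k t v)) \<longlonglongrightarrow> 0)) \<and>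
         integrable (lebesgue_on {0<..<T}) (\<lambda>t. (Hminus1_norm \<Omega> (f t))\<^sup>2)}"

definition discrete_dual_norm ::
    "(real ^ 'n) set \<Rightarrow> real \<Rightarrow> nat \<Rightarrow>
     (real \<Rightarrow> (real ^ 'n \<Rightarrow> real ^ 'n) \<Rightarrow> real) \<Rightarrow> real" where
  "discrete_dual_norm \<Omega> \<Delta>t M f =
     sqrt (\<Delta>t * (\<Sum>n = 0..M. (Hminus1_norm \<Omega> (f (real n * \<Delta>t)))\<^sup>2))"


section \<open>Proper orthogonal decomposition\<close>

text \<open>A finite-dimensional subspace of \<open>(H\<^sub>0\<^sup>1(\<Omega>))\<^sup>\<ell>\<close> consisting of piecewise polynomial fields on
  a mesh of polytopal cells.\<close>

definition conforming_fe_space ::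
    "(real ^ 'n) set \<Rightarrow> (real ^ 'n \<Rightarrow> real ^ 'n) set \<Rightarrow> bool" where
  "conforming_fe_space \<Omega> Xh \<longleftrightarrow>
     Xh \<subseteq> velocity_space \<Omega> \<and>
     (\<exists>d \<phi>. Xh = l2_span \<Omega> d \<phi>) \<and>
     (\<exists>\<T>. finite \<T> \<and> (\<forall>K\<in>\<T>. polytope K \<and> interior K \<noteq> {}) \<and>
          pairwise (\<lambda>K L. interior K \<inter> interior L = {}) \<T> \<and> \<Union>\<T> = closure \<Omega> \<and>
          (\<forall>v\<in>Xh. \<forall>K\<in>\<T>. \<exists>p. polynomial_function p \<and>
             (AE x in lebesgue_on \<Omega>. x \<in> K \<longrightarrow> v x = p x)))"

definition snapshot_error ::
    "'a::euclidean_space set \<Rightarrow> nat \<Rightarrow> (nat \<Rightarrow> 'a \<Rightarrow> 'b::euclidean_space) \<Rightarrow>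
     nat \<Rightarrow> (nat \<Rightarrow> 'a \<Rightarrow> 'b) \<Rightarrow> real" where
  "snapshot_error \<Omega> N S r \<phi> =
     (\<Sum>j = 1..N. (l2_norm \<Omega> (\<lambda>x. S j x - (\<Sum>i = 1..r. l2_inner \<Omega> (S j) (\<phi> i) *\<^sub>R \<phi> i x)))\<^sup>2)"

text \<open>An orthonormal family in the span of the snapshots \<open>S 1, \<dots>, S N\<close> minimizing the total squared
  projection error; membership in the span expresses that \<open>r\<close> does not exceed the rank of the
  snapshots.\<close>

definition pod_basis ::
    "'a::euclidean_space set \<Rightarrow> nat \<Rightarrow> (nat \<Rightarrow> 'a \<Rightarrow> 'b::euclidean_space) \<Rightarrow>
     nat \<Rightarrow> (nat \<Rightarrow> 'a \<Rightarrow> 'b) \<Rightarrow> bool" where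
  "pod_basis \<Omega> N S r \<psi> \<longleftrightarrow>
     l2_orthonormal \<Omega> r \<psi> \<and>
     (\<forall>i\<in>{1..r}. \<psi> i \<in> l2_span \<Omega> N S) \<and>
     (\<forall>\<phi>. l2_orthonormal \<Omega> r \<phi> \<longrightarrow> snapshot_error \<Omega> N S r \<psi> \<le> snapshot_error \<Omega> N S r \<phi>)"

text \<open>\<open>(I - P\<^sub>R) \<nabla>v\<close>, where \<open>P\<^sub>R\<close> projects onto the span of \<open>\<nabla>\<psi>\<^sub>1, \<dots>, \<nabla>\<psi>\<^sub>R\<close>.\<close>

definition grad_fluctuation ::
    "(real ^ 'n) set \<Rightarrow> (nat \<Rightarrow> real ^ 'n \<Rightarrow> real ^ 'n) \<Rightarrow> nat \<Rightarrow>
     (real ^ 'n \<Rightarrow> real ^ 'n) \<Rightarrow> real ^ 'n \<Rightarrow> real ^ 'n ^ 'n" where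
  "grad_fluctuation \<Omega> \<psi> R v x =
     grad \<Omega> v x - l2_proj \<Omega> (l2_span \<Omega> R (\<lambda>i. grad \<Omega> (\<psi> i))) (grad \<Omega> v) x"

end

theory Submission imports Defs begin

text \<open>Testing Step 1 with \<open>\<phi> = w\<^sup>n\<^sup>+\<^sup>1\<close> removes the skew-symmetric convective term; polarization,
  the duality estimate \<open>f(w) \<le> \<parallel>f\<parallel>\<^sub>-\<^sub>1 \<parallel>\<nabla>w\<parallel>\<close> and Young's inequality bound \<open>\<parallel>w\<^sup>n\<^sup>+\<^sup>1\<parallel>\<^sup>2 - \<parallel>u\<^sup>n\<parallel>\<^sup>2\<close>.
  Testing Step 2 with the midpoint \<open>(w\<^sup>n\<^sup>+\<^sup>1 + u\<^sup>n\<^sup>+\<^sup>1) / 2\<close> gives \<open>\<parallel>w\<^sup>n\<^sup>+\<^sup>1\<parallel>\<^sup>2 - \<parallel>u\<^sup>n\<^sup>+\<^sup>1\<parallel>\<^sup>2\<close> exactly.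
  Adding the two and summing over \<open>n\<close> telescopes. The duality estimate needs \<open>w\<^sup>n\<^sup>+\<^sup>1\<close> to be in
  \<open>(H\<^sub>0\<^sup>1)\<^sup>\<ell>\<close>, hence the closure of that space under linear combinations and almost everywhere
  equality.\<close>

section \<open>Square integrable fields\<close>

lemma borel_measurable_lebesgue_on_AE:
  fixes f g :: "'a::euclidean_space \<Rightarrow> 'b::euclidean_space"
  assumes S: "S \<in> sets lebesgue" and f: "f \<in> borel_measurable (lebesgue_on S)"
    and ae: "AE x in lebesgue_on S. g x = f x"
  shows "g \<in> borel_measurable (lebesgue_on S)"
proof -
  \<comment> \<open>Extension by zero moves the question to the whole space, where completeness of
    Lebesgue measure lets a measurable function be changed on a null set.\<close>
  have "(\<lambda>x. if x \<in> S then f x else 0) \<in> borel_measurable lebesgue"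
    using S f by (simp add: borel_measurable_if)
  moreover have "AE x in lebesgue. (if x \<in> S then f x else 0) = (if x \<in> S then g x else 0)"
    using ae S by (subst (asm) AE_restrict_space_iff) (auto elim!: eventually_mono)
  ultimately have "(\<lambda>x. if x \<in> S then g x else 0) \<in> borel_measurable lebesgue"
    by (rule borel_measurable_AE)
  then show ?thesis
    using S by (simp add: borel_measurable_if)
qed

lemma L2_AE:
  fixes f g :: "'a::euclidean_space \<Rightarrow> 'b::euclidean_space"
  assumes S: "S \<in> sets lebesgue" and f: "f \<in> L2 S"
    and ae: "AE x in lebesgue_on S. g x = f x"
  shows "g \<in> L2 S"
proof -
  have [measurable]: "f \<in> borel_measurable (lebesgue_on S)"
    using f by (simp add: L2_def)
  have [measurable]: "g \<in> borel_measurable (lebesgue_on S)"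
    by (rule borel_measurable_lebesgue_on_AE[OF S _ ae]) measurable
  have "integrable (lebesgue_on S) (\<lambda>x. (norm (g x))\<^sup>2) =
        integrable (lebesgue_on S) (\<lambda>x. (norm (f x))\<^sup>2)"
    by (rule integrable_cong_AE) (use ae in auto)
  then show ?thesis
    using f by (simp add: L2_def)
qed

text \<open>The elementary \<open>(p + q)^2 \<le> 2 p^2 + 2 q^2\<close> stands in for Minkowski's
  inequality: it can be integrated termwise, and its constant is harmless both for integrability and
  for limits equal to 0.\<close>

lemma power2_norm_linear_combination_le:
  fixes x y :: "'b::real_inner"
  shows "(norm (a *\<^sub>R x + b *\<^sub>R y))\<^sup>2 \<le> 2 * a\<^sup>2 * (norm x)\<^sup>2 + 2 * b\<^sup>2 * (norm y)\<^sup>2"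
proof -
  have "norm (a *\<^sub>R x + b *\<^sub>R y) \<le> \<bar>a\<bar> * norm x + \<bar>b\<bar> * norm y"
    by (metis norm_scaleR norm_triangle_ineq)
  then have "(norm (a *\<^sub>R x + b *\<^sub>R y))\<^sup>2 \<le> (\<bar>a\<bar> * norm x + \<bar>b\<bar> * norm y)\<^sup>2"
    by (simp add: power_mono)
  also have "\<dots> \<le> 2 * (\<bar>a\<bar> * norm x)\<^sup>2 + 2 * (\<bar>b\<bar> * norm y)\<^sup>2"
    using zero_le_power2[of "\<bar>a\<bar> * norm x - \<bar>b\<bar> * norm y"]
    by (simp add: power2_sum power2_diff)
  finally show ?thesis
    by (simp add: power_mult_distrib)
qed

lemma L2_linear_combination:
  assumes f: "f \<in> L2 S" and g: "g \<in> L2 S"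
  shows "(\<lambda>x. a *\<^sub>R f x + b *\<^sub>R g x) \<in> L2 S"
proof -
  have [measurable]: "f \<in> borel_measurable (lebesgue_on S)" "g \<in> borel_measurable (lebesgue_on S)"
    using f g by (auto simp: L2_def)
  have "integrable (lebesgue_on S) (\<lambda>x. 2 * a\<^sup>2 * (norm (f x))\<^sup>2 + 2 * b\<^sup>2 * (norm (g x))\<^sup>2)"
    using f g by (auto simp: L2_def)
  then have "integrable (lebesgue_on S) (\<lambda>x. (norm (a *\<^sub>R f x + b *\<^sub>R g x))\<^sup>2)"
    by (rule Bochner_Integration.integrable_bound)
       (auto intro!: AE_I2 order_trans[OF power2_norm_linear_combination_le])
  then show ?thesis
    by (simp add: L2_def)
qed

lemma zero_in_L2: "(\<lambda>x. 0) \<in> L2 S"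
  by (simp add: L2_def)

lemma L2_diff:
  assumes "f \<in> L2 S" "g \<in> L2 S"
  shows "(\<lambda>x. f x - g x) \<in> L2 S"
  using L2_linear_combination[OF assms, of 1 "-1"] by simp

lemma L2_component:
  fixes G :: "'a::euclidean_space \<Rightarrow> real ^ 'n"
  assumes "G \<in> L2 S"
  shows "(\<lambda>x. G x $ j) \<in> L2 S"
proof -
  have [measurable]: "G \<in> borel_measurable (lebesgue_on S)"
    using assms by (simp add: L2_def)
  have "(\<lambda>x. G x \<bullet> axis j 1) \<in> borel_measurable (lebesgue_on S)"
    by measurable
  then have m: "(\<lambda>x. G x $ j) \<in> borel_measurable (lebesgue_on S)"
    by (simp add: inner_axis)
  have "integrable (lebesgue_on S) (\<lambda>x. (norm (G x))\<^sup>2)"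
    using assms by (simp add: L2_def)
  then have "integrable (lebesgue_on S) (\<lambda>x. (norm (G x $ j))\<^sup>2)"
    by (rule Bochner_Integration.integrable_bound)
       (use m component_le_norm_cart[of "G _" j] in \<open>auto simp: abs_le_square_iff[symmetric]\<close>)
  then show ?thesis
    using m by (simp add: L2_def)
qed

text \<open>Cauchy-Schwarz and \<open>2 p q \<le> p^2 + q^2\<close> give an integrable dominating
  function. Later splittings of integrals of inner products rest on this.\<close>

lemma integrable_L2_inner:
  assumes f: "f \<in> L2 S" and g: "g \<in> L2 S"
  shows "integrable (lebesgue_on S) (\<lambda>x. f x \<bullet> g x)"
proof -
  have [measurable]: "f \<in> borel_measurable (lebesgue_on S)" "g \<in> borel_measurable (lebesgue_on S)"
    using f g by (auto simp: L2_def)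
  have bound: "\<bar>f x \<bullet> g x\<bar> \<le> (norm (f x))\<^sup>2 + (norm (g x))\<^sup>2" for x
  proof -
    have "2 * norm (f x) * norm (g x) \<le> (norm (f x))\<^sup>2 + (norm (g x))\<^sup>2"
      by (rule sum_squares_bound)
    moreover have "0 \<le> norm (f x) * norm (g x)"
      by simp
    ultimately show ?thesis
      using Cauchy_Schwarz_ineq2[of "f x" "g x"] by linarith
  qed
  have "integrable (lebesgue_on S) (\<lambda>x. (norm (f x))\<^sup>2 + (norm (g x))\<^sup>2)"
    using f g by (auto simp: L2_def)
  then show ?thesis
    by (rule Bochner_Integration.integrable_bound) (use bound in auto)
qed

section \<open>The L2 norm: null sequences and the two energy identities\<close>

lemma l2_inner_self_nonneg: "0 \<le> l2_inner S f f"
  by (simp add: l2_inner_def)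

lemma l2_norm_nonneg: "0 \<le> l2_norm S f"
  by (simp add: l2_norm_def l2_inner_self_nonneg)

text \<open>A nonintegrable integrand has integral 0 by convention, so this identity and the scaling
  rule below hold for arbitrary fields. They are applied to gradients and fluctuations, whose square
  integrability is nowhere established.\<close>

lemma power2_l2_norm: "(l2_norm S f)\<^sup>2 = l2_inner S f f"
  by (simp add: l2_norm_def l2_inner_self_nonneg)

lemma l2_inner_scaleR_left: "l2_inner S (\<lambda>x. a *\<^sub>R f x) g = a * l2_inner S f g"
  by (simp add: l2_inner_def)

lemma l2_norm_cong_AE:
  assumes "f \<in> borel_measurable (lebesgue_on S)" "g \<in> borel_measurable (lebesgue_on S)"
    and "AE x in lebesgue_on S. f x = g x"
  shows "l2_norm S f = l2_norm S g"
  unfolding l2_norm_def l2_inner_def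
  using assms by (intro arg_cong[where f = sqrt] integral_cong_AE) auto

lemma power2_l2_norm_linear_combination_le:
  assumes f: "f \<in> L2 S" and g: "g \<in> L2 S"
  shows "(l2_norm S (\<lambda>x. a *\<^sub>R f x + b *\<^sub>R g x))\<^sup>2 \<le>
         2 * a\<^sup>2 * (l2_norm S f)\<^sup>2 + 2 * b\<^sup>2 * (l2_norm S g)\<^sup>2"
proof -
  have int: "integrable (lebesgue_on S) (\<lambda>x. (norm (f x))\<^sup>2)"
    "integrable (lebesgue_on S) (\<lambda>x. (norm (g x))\<^sup>2)"
    "integrable (lebesgue_on S) (\<lambda>x. (norm (a *\<^sub>R f x + b *\<^sub>R g x))\<^sup>2)"
    using f g L2_linear_combination[OF f g, of a b] by (auto simp: L2_def)
  have "(LINT x|lebesgue_on S. (norm (a *\<^sub>R f x + b *\<^sub>R g x))\<^sup>2) \<le>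
        (LINT x|lebesgue_on S. 2 * a\<^sup>2 * (norm (f x))\<^sup>2 + 2 * b\<^sup>2 * (norm (g x))\<^sup>2)"
    using int by (intro integral_mono power2_norm_linear_combination_le) auto
  also have "\<dots> = 2 * a\<^sup>2 * (LINT x|lebesgue_on S. (norm (f x))\<^sup>2) +
                 2 * b\<^sup>2 * (LINT x|lebesgue_on S. (norm (g x))\<^sup>2)"
    using int by simp
  finally show ?thesis
    unfolding power2_l2_norm l2_inner_def dot_square_norm .
qed

text \<open>It suffices to squeeze the squares between 0 and the preceding bound, since a sequence
  tends to 0 when its squares do.\<close>

lemma l2_norm_linear_combination_tendsto_0:
  assumes L2: "\<And>k. f k \<in> L2 S" "\<And>k. g k \<in> L2 S"
    and f: "(\<lambda>k. l2_norm S (f k)) \<longlonglongrightarrow> 0" and g: "(\<lambda>k. l2_norm S (g k)) \<longlonglongrightarrow> 0"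
  shows "(\<lambda>k. l2_norm S (\<lambda>x. a *\<^sub>R f k x + b *\<^sub>R g k x)) \<longlonglongrightarrow> 0"
proof -
  have "(\<lambda>k. 2 * a\<^sup>2 * (l2_norm S (f k))\<^sup>2 + 2 * b\<^sup>2 * (l2_norm S (g k))\<^sup>2)
          \<longlonglongrightarrow> 2 * a\<^sup>2 * 0\<^sup>2 + 2 * b\<^sup>2 * 0\<^sup>2"
    by (intro tendsto_intros f g)
  then have lim: "(\<lambda>k. 2 * a\<^sup>2 * (l2_norm S (f k))\<^sup>2 + 2 * b\<^sup>2 * (l2_norm S (g k))\<^sup>2) \<longlonglongrightarrow> 0"
    by simp
  have "(\<lambda>k. (l2_norm S (\<lambda>x. a *\<^sub>R f k x + b *\<^sub>R g k x))\<^sup>2) \<longlonglongrightarrow> 0"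
    by (rule tendsto_sandwich[OF _ _ tendsto_const lim])
       (auto intro!: always_eventually power2_l2_norm_linear_combination_le L2)
  then show ?thesis
    by simp
qed

text \<open>Source of the numerical dissipation: pairing the increment with the newer value
  \<open>w\<close> leaves, besides the change of energy, the square of the increment.\<close>

lemma l2_inner_polarization:
  assumes u: "u \<in> L2 S" and w: "w \<in> L2 S"
  shows "2 * l2_inner S (\<lambda>x. w x - u x) w =
         (l2_norm S w)\<^sup>2 - (l2_norm S u)\<^sup>2 + (l2_norm S (\<lambda>x. w x - u x))\<^sup>2"
proof -
  have int: "integrable (lebesgue_on S) (\<lambda>x. w x \<bullet> w x)" "integrable (lebesgue_on S) (\<lambda>x. u x \<bullet> u x)"
    "integrable (lebesgue_on S) (\<lambda>x. u x \<bullet> w x)"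
    using u w by (auto intro: integrable_L2_inner)
  have "(w x - u x) \<bullet> (w x - u x) = w x \<bullet> w x - 2 * (u x \<bullet> w x) + u x \<bullet> u x" for x
    by (simp add: inner_diff inner_commute)
  then show ?thesis
    using int unfolding power2_l2_norm l2_inner_def by (simp add: inner_diff_left)
qed

text \<open>Pairing with the midpoint is a plain difference of squares. No increment term remains,
  so Step 2 yields an equality.\<close>

lemma l2_inner_diff_midpoint:
  assumes u: "u \<in> L2 S" and w: "w \<in> L2 S"
  shows "2 * l2_inner S (\<lambda>x. w x - u x) (\<lambda>x. (w x + u x) /\<^sub>R 2) = (l2_norm S w)\<^sup>2 - (l2_norm S u)\<^sup>2"
proof -
  have int: "integrable (lebesgue_on S) (\<lambda>x. w x \<bullet> w x)" "integrable (lebesgue_on S) (\<lambda>x. u x \<bullet> u x)"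
    using u w by (auto intro: integrable_L2_inner)
  have "(w x - u x) \<bullet> (w x + u x) = w x \<bullet> w x - u x \<bullet> u x" for x
    by (simp add: inner_diff_left inner_diff_right inner_add_left inner_add_right inner_commute)
  then show ?thesis
    using int unfolding power2_l2_norm l2_inner_def by simp
qed

section \<open>Linear combinations in \<open>(H\<^sub>0\<^sup>1(\<Omega>))\<^sup>\<ell>\<close>\<close>

lemma frechet_derivative_linear_combination:
  fixes f g :: "'a::real_normed_vector \<Rightarrow> real"
  assumes "f differentiable (at x)" "g differentiable (at x)"
  shows "frechet_derivative (\<lambda>x. a * f x + b * g x) (at x) =
         (\<lambda>e. a * frechet_derivative f (at x) e + b * frechet_derivative g (at x) e)"
  using assms unfolding frechet_derivative_works
  by (intro frechet_derivative_at[symmetric] derivative_intros)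

lemma continuously_diff_linear_combination:
  assumes "continuously_diff k f" "continuously_diff k g"
  shows "continuously_diff k (\<lambda>x. a * f x + b * g x)"
  using assms
\<comment> \<open>\<open>f\<close> and \<open>g\<close> are generalized because the induction
  hypothesis is applied to their directional derivatives.\<close>
proof (induction k arbitrary: f g)
  case 0
  then show ?case
    by (auto intro!: continuous_intros)
next
  case (Suc k)
  then show ?case
    by (auto simp: frechet_derivative_linear_combination intro!: derivative_intros)
qed

text \<open>The combination can be nonzero only where \<open>f\<close> or \<open>g\<close> is, so
  its support is a closed subset of the compact union \<open>?K\<close>.\<close>

lemma test_functions_linear_combination:
  assumes f: "f \<in> test_functions \<Omega>" and g: "g \<in> test_functions \<Omega>"
  shows "(\<lambda>x. a * f x + b * g x) \<in> test_functions \<Omega>"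
proof -
  let ?K = "closure {x. f x \<noteq> 0} \<union> closure {x. g x \<noteq> 0}"
  have K: "compact ?K" "?K \<subseteq> \<Omega>"
    using f g by (auto simp: test_functions_def)
  have sub: "closure {x. a * f x + b * g x \<noteq> 0} \<subseteq> ?K"
    unfolding closure_Un[symmetric] by (rule closure_mono) auto
  have "compact (closure {x. a * f x + b * g x \<noteq> 0})"
    using compact_Int_closed[OF K(1) closed_closure, of "{x. a * f x + b * g x \<noteq> 0}"] sub
    by (simp add: Int_absorb1)
  then show ?thesis
    using f g sub K by (auto simp: test_functions_def intro!: continuously_diff_linear_combination)
qed

lemma test_functions_differentiable:
  "\<phi> \<in> test_functions \<Omega> \<Longrightarrow> \<phi> differentiable (at x)"
  by (auto simp: test_functions_def dest: spec[of _ "Suc 0"])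

lemma zero_in_test_functions: "(\<lambda>x::'a::euclidean_space. 0) \<in> test_functions \<Omega>"
proof -
  have "continuously_diff k (\<lambda>x::'a. 0)" for k
    by (induction k) auto
  then show ?thesis
    by (simp add: test_functions_def)
qed

lemma classical_gradient_linear_combination:
  assumes "f \<in> test_functions \<Omega>" "g \<in> test_functions \<Omega>"
  shows "classical_gradient (\<lambda>x. a * f x + b * g x) x =
         a *\<^sub>R classical_gradient f x + b *\<^sub>R classical_gradient g x"
  using assms
  by (simp add: classical_gradient_def vec_eq_iff frechet_derivative_linear_combination
      test_functions_differentiable)

text \<open>A continuous function is bounded on the compact closure of \<open>S\<close>, and
  \<open>S\<close> has finite measure.\<close>

lemma continuous_imp_L2:
  fixes g :: "'a::euclidean_space \<Rightarrow> 'b::euclidean_space"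
  assumes S: "bounded S" "S \<in> sets lebesgue" and g: "continuous_on UNIV g"
  shows "g \<in> L2 S"
proof -
  have gS: "g \<in> borel_measurable (lebesgue_on S)"
    using g S(2) by (intro continuous_imp_measurable_on_sets_lebesgue) (auto intro: continuous_on_subset)
  have "bounded (g ` closure S)"
    using S(1) g by (intro compact_imp_bounded compact_continuous_image)
      (auto intro: continuous_on_subset)
  then obtain B where B: "\<And>x. x \<in> S \<Longrightarrow> norm (g x) \<le> B"
    using closure_subset[of S] unfolding bounded_iff by blast
  interpret finite_measure "lebesgue_on S"
    using S by (intro finite_measure_lebesgue_on bounded_set_imp_lmeasurable)
  have "integrable (lebesgue_on S) (\<lambda>x. (norm (g x))\<^sup>2)"
    by (rule integrable_const_bound[where B = "B\<^sup>2"])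
       (use gS B in \<open>auto intro!: AE_I2 power_mono\<close>)
  then show ?thesis
    using gS by (simp add: L2_def)
qed

lemma test_functions_L2:
  assumes "bounded \<Omega>" "\<Omega> \<in> sets lebesgue" "\<phi> \<in> test_functions \<Omega>"
  shows "\<phi> \<in> L2 \<Omega>"
  using assms by (intro continuous_imp_L2) (auto simp: test_functions_def dest: spec[of _ "0::nat"])

lemma classical_gradient_L2:
  assumes "bounded \<Omega>" "\<Omega> \<in> sets lebesgue" "\<phi> \<in> test_functions \<Omega>"
  shows "classical_gradient \<phi> \<in> L2 \<Omega>"
proof -
  have "continuous_on UNIV (\<lambda>x. frechet_derivative \<phi> (at x) (axis j 1))" for j
    using assms(3) by (auto simp: test_functions_def axis_in_Basis_iff dest: spec[of _ "Suc 0"])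
  then have "continuous_on UNIV (classical_gradient \<phi>)"
    unfolding classical_gradient_def[abs_def] by (intro continuous_on_vec_lambda)
  then show ?thesis
    using assms by (intro continuous_imp_L2)
qed

section \<open>Weak gradients and \<open>H10\<close>\<close>

lemma is_weak_gradient_linear_combination:
  assumes \<Omega>: "bounded \<Omega>" "\<Omega> \<in> sets lebesgue"
    and L2: "v \<in> L2 \<Omega>" "v' \<in> L2 \<Omega>"
    and G: "is_weak_gradient \<Omega> v G" "is_weak_gradient \<Omega> v' G'"
  shows "is_weak_gradient \<Omega> (\<lambda>x. a * v x + b * v' x) (\<lambda>x. a *\<^sub>R G x + b *\<^sub>R G' x)"
  unfolding is_weak_gradient_def
proof (intro conjI ballI allI)
  have GL2: "G \<in> L2 \<Omega>" "G' \<in> L2 \<Omega>"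
    using G by (auto simp: is_weak_gradient_def)
  show "(\<lambda>x. a *\<^sub>R G x + b *\<^sub>R G' x) \<in> L2 \<Omega>"
    by (rule L2_linear_combination[OF GL2])
  fix \<phi> j assume \<phi>: "\<phi> \<in> test_functions \<Omega>"
  \<comment> \<open>Splitting the integrals requires every product to be integrable. Each one pairs
    two L2 functions, as test functions and their gradients lie in \<open>L2 \<Omega>\<close> on the
    bounded set.\<close>
  have int1: "integrable (lebesgue_on \<Omega>) (\<lambda>x. h x * classical_gradient \<phi> x $ j)" if "h \<in> L2 \<Omega>" for h
    using integrable_L2_inner[OF that L2_component[OF classical_gradient_L2[OF \<Omega> \<phi>]]] by simp
  have int2: "integrable (lebesgue_on \<Omega>) (\<lambda>x. H x $ j * \<phi> x)" if "H \<in> L2 \<Omega>" for H :: "real^'a \<Rightarrow> real^'a"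
    using integrable_L2_inner[OF L2_component[OF that] test_functions_L2[OF \<Omega> \<phi>]] by simp
  have eq: "(LINT x|lebesgue_on \<Omega>. v x * classical_gradient \<phi> x $ j) =
            - (LINT x|lebesgue_on \<Omega>. G x $ j * \<phi> x)"
    "(LINT x|lebesgue_on \<Omega>. v' x * classical_gradient \<phi> x $ j) =
            - (LINT x|lebesgue_on \<Omega>. G' x $ j * \<phi> x)"
    using G \<phi> by (auto simp: is_weak_gradient_def)
  have "(LINT x|lebesgue_on \<Omega>. (a * v x + b * v' x) * classical_gradient \<phi> x $ j) =
        a * (LINT x|lebesgue_on \<Omega>. v x * classical_gradient \<phi> x $ j) +
        b * (LINT x|lebesgue_on \<Omega>. v' x * classical_gradient \<phi> x $ j)"
    using int1[OF L2(1)] int1[OF L2(2)] by (simp add: distrib_right mult.assoc)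
  also have "\<dots> = - (LINT x|lebesgue_on \<Omega>. (a *\<^sub>R G x + b *\<^sub>R G' x) $ j * \<phi> x)"
    using int2[OF GL2(1)] int2[OF GL2(2)] by (simp add: eq distrib_right mult.assoc)
  finally show "(LINT x|lebesgue_on \<Omega>. (a * v x + b * v' x) * classical_gradient \<phi> x $ j) =
        - (LINT x|lebesgue_on \<Omega>. (a *\<^sub>R G x + b *\<^sub>R G' x) $ j * \<phi> x)" .
qed

text \<open>The witnesses are the same linear combinations of the weak gradients and of the
  approximating test functions. Both approximation errors are then combinations of errors that tend
  to 0 in norm.\<close>

lemma H10_linear_combination:
  assumes \<Omega>: "bounded \<Omega>" "\<Omega> \<in> sets lebesgue"
    and v: "v \<in> H10 \<Omega>" and v': "v' \<in> H10 \<Omega>"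
  shows "(\<lambda>x. a * v x + b * v' x) \<in> H10 \<Omega>"
proof -
  obtain G \<phi> where G: "is_weak_gradient \<Omega> v G" and \<phi>: "\<And>k. \<phi> k \<in> test_functions \<Omega>"
    and lim: "(\<lambda>k. l2_norm \<Omega> (\<lambda>x. v x - \<phi> k x)) \<longlonglongrightarrow> 0"
      "(\<lambda>k. l2_norm \<Omega> (\<lambda>x. G x - classical_gradient (\<phi> k) x)) \<longlonglongrightarrow> 0"
    using v by (auto simp: H10_def)
  obtain G' \<phi>' where G': "is_weak_gradient \<Omega> v' G'" and \<phi>': "\<And>k. \<phi>' k \<in> test_functions \<Omega>"
    and lim': "(\<lambda>k. l2_norm \<Omega> (\<lambda>x. v' x - \<phi>' k x)) \<longlonglongrightarrow> 0"
      "(\<lambda>k. l2_norm \<Omega> (\<lambda>x. G' x - classical_gradient (\<phi>' k) x)) \<longlonglongrightarrow> 0"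
    using v' by (auto simp: H10_def)
  have L2: "v \<in> L2 \<Omega>" "v' \<in> L2 \<Omega>" "G \<in> L2 \<Omega>" "G' \<in> L2 \<Omega>"
    using v v' G G' by (auto simp: H10_def is_weak_gradient_def)
  let ?\<phi> = "\<lambda>k x. a * \<phi> k x + b * \<phi>' k x"
  have "(\<lambda>k. l2_norm \<Omega> (\<lambda>x. a *\<^sub>R (v x - \<phi> k x) + b *\<^sub>R (v' x - \<phi>' k x))) \<longlonglongrightarrow> 0"
    by (intro l2_norm_linear_combination_tendsto_0 lim lim' L2_diff L2 test_functions_L2[OF \<Omega>] \<phi> \<phi>')
  then have "(\<lambda>k. l2_norm \<Omega> (\<lambda>x. (a * v x + b * v' x) - ?\<phi> k x)) \<longlonglongrightarrow> 0"
    by (simp add: algebra_simps)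
  moreover
  have "(\<lambda>k. l2_norm \<Omega> (\<lambda>x. a *\<^sub>R (G x - classical_gradient (\<phi> k) x) +
                           b *\<^sub>R (G' x - classical_gradient (\<phi>' k) x))) \<longlonglongrightarrow> 0"
    by (intro l2_norm_linear_combination_tendsto_0 lim lim' L2_diff L2 classical_gradient_L2[OF \<Omega>] \<phi> \<phi>')
  then have "(\<lambda>k. l2_norm \<Omega> (\<lambda>x. (a *\<^sub>R G x + b *\<^sub>R G' x) - classical_gradient (?\<phi> k) x)) \<longlonglongrightarrow> 0"
    by (simp add: classical_gradient_linear_combination[OF \<phi> \<phi>'] algebra_simps)
  moreover have "\<forall>k. ?\<phi> k \<in> test_functions \<Omega>"
    by (intro allI test_functions_linear_combination \<phi> \<phi>')
  moreover have "is_weak_gradient \<Omega> (\<lambda>x. a * v x + b * v' x) (\<lambda>x. a *\<^sub>R G x + b *\<^sub>R G' x)"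
    by (rule is_weak_gradient_linear_combination[OF \<Omega> L2(1,2) G G'])
  moreover have "(\<lambda>x. a * v x + b * v' x) \<in> L2 \<Omega>"
    using L2_linear_combination[OF L2(1,2)] by simp
  ultimately show ?thesis
    unfolding H10_def
    by (intro CollectI conjI exI[of _ "\<lambda>x. a *\<^sub>R G x + b *\<^sub>R G' x"] exI[of _ ?\<phi>])
qed

lemma zero_in_H10: "(\<lambda>x. 0) \<in> H10 \<Omega>"
proof -
  have "is_weak_gradient \<Omega> (\<lambda>x. 0::real) (\<lambda>x. 0)"
    by (simp add: is_weak_gradient_def zero_in_L2)
  moreover have "classical_gradient (\<lambda>x::real^'a. 0) = (\<lambda>x. 0)"
    by (simp add: classical_gradient_def fun_eq_iff vec_eq_iff)
  ultimately show ?thesis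
    unfolding H10_def
    by (intro CollectI conjI exI[of _ "\<lambda>x::real^'a. 0::real^'a"] exI[of _ "\<lambda>k (x::real^'a). 0::real"])
       (auto simp: zero_in_L2 l2_norm_def l2_inner_def zero_in_test_functions)
qed

text \<open>Members of \<open>l2_span\<close> are prescribed only almost everywhere, hence this
  transfer. The gradient \<open>G\<close> and the approximating sequence of \<open>v\<close> also
  serve for \<open>v'\<close>, because \<open>v\<close> enters \<open>H10\<close> only through
  measurability and integrals, which ignore null sets.\<close>

lemma H10_AE:
  assumes \<Omega>: "bounded \<Omega>" "\<Omega> \<in> sets lebesgue"
    and v: "v \<in> H10 \<Omega>" and ae: "AE x in lebesgue_on \<Omega>. v' x = v x"
  shows "v' \<in> H10 \<Omega>"
proof -
  obtain G \<phi> where G: "is_weak_gradient \<Omega> v G" and \<phi>: "\<And>k. \<phi> k \<in> test_functions \<Omega>"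
    and lim: "(\<lambda>k. l2_norm \<Omega> (\<lambda>x. v x - \<phi> k x)) \<longlonglongrightarrow> 0"
      "(\<lambda>k. l2_norm \<Omega> (\<lambda>x. G x - classical_gradient (\<phi> k) x)) \<longlonglongrightarrow> 0"
    using v by (auto simp: H10_def)
  have L2: "v \<in> L2 \<Omega>" "v' \<in> L2 \<Omega>"
    using v L2_AE[OF \<Omega>(2) _ ae] by (auto simp: H10_def)
  have [measurable]: "v \<in> borel_measurable (lebesgue_on \<Omega>)" "v' \<in> borel_measurable (lebesgue_on \<Omega>)"
    using L2 by (auto simp: L2_def)
  have [measurable]: "\<phi> k \<in> borel_measurable (lebesgue_on \<Omega>)" for k
    using test_functions_L2[OF \<Omega> \<phi>] by (simp add: L2_def)
  have "l2_norm \<Omega> (\<lambda>x. v' x - \<phi> k x) = l2_norm \<Omega> (\<lambda>x. v x - \<phi> k x)" for k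
    by (rule l2_norm_cong_AE) (use ae in auto)
  then have "(\<lambda>k. l2_norm \<Omega> (\<lambda>x. v' x - \<phi> k x)) \<longlonglongrightarrow> 0"
    using lim(1) by simp
  moreover have "(LINT x|lebesgue_on \<Omega>. v' x * classical_gradient \<eta> x $ j) =
      (LINT x|lebesgue_on \<Omega>. v x * classical_gradient \<eta> x $ j)" if "\<eta> \<in> test_functions \<Omega>" for \<eta> j
  proof -
    have [measurable]: "(\<lambda>x. classical_gradient \<eta> x $ j) \<in> borel_measurable (lebesgue_on \<Omega>)"
      using L2_component[OF classical_gradient_L2[OF \<Omega> that]] by (simp add: L2_def)
    show ?thesis
      by (rule integral_cong_AE) (use ae in auto)
  qed
  then have "is_weak_gradient \<Omega> v' G"
    using G by (simp add: is_weak_gradient_def)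
  ultimately show ?thesis
    using L2 \<phi> lim unfolding H10_def by blast
qed

section \<open>Fields in the span of the POD basis\<close>

lemma velocity_space_l2_span:
  assumes \<Omega>: "bounded \<Omega>" "\<Omega> \<in> sets lebesgue"
    and \<psi>: "\<forall>i\<in>{1..r}. \<psi> i \<in> velocity_space \<Omega>" and v: "v \<in> l2_span \<Omega> r \<psi>"
  shows "v \<in> velocity_space \<Omega>"
  unfolding velocity_space_def
proof (intro CollectI allI)
  fix j
  obtain c where c: "AE x in lebesgue_on \<Omega>. v x = (\<Sum>i = 1..r. c i *\<^sub>R \<psi> i x)"
    using v by (auto simp: l2_span_def)
  \<comment> \<open>Passing to arbitrary finite \<open>I\<close> within \<open>{1..r}\<close> allows
    induction from the zero function. \<open>H10_AE\<close> afterwards leads from the sum to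
    \<open>v\<close>.\<close>
  have "(\<lambda>x. \<Sum>i\<in>I. c i * \<psi> i x $ j) \<in> H10 \<Omega>" if "finite I" "I \<subseteq> {1..r}" for I
    using that
  proof (induction I rule: finite_induct)
    case empty
    then show ?case
      by (simp add: zero_in_H10)
  next
    case (insert k I)
    then have "(\<lambda>x. \<psi> k x $ j) \<in> H10 \<Omega>" "(\<lambda>x. \<Sum>i\<in>I. c i * \<psi> i x $ j) \<in> H10 \<Omega>"
      using \<psi> by (auto simp: velocity_space_def)
    from H10_linear_combination[OF \<Omega> this, of "c k" 1] insert(1,2) show ?case
      by simp
  qed
  then have "(\<lambda>x. \<Sum>i = 1..r. c i * \<psi> i x $ j) \<in> H10 \<Omega>"
    by simp
  then show "(\<lambda>x. v x $ j) \<in> H10 \<Omega>"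
    by (rule H10_AE[OF \<Omega>]) (use c in \<open>auto elim!: eventually_mono\<close>)
qed

lemma L2_l2_span:
  assumes S: "S \<in> sets lebesgue" and \<psi>: "\<forall>i\<in>{1..r}. \<psi> i \<in> L2 S" and v: "v \<in> l2_span S r \<psi>"
  shows "v \<in> L2 S"
proof -
  obtain c where c: "AE x in lebesgue_on S. v x = (\<Sum>i = 1..r. c i *\<^sub>R \<psi> i x)"
    using v by (auto simp: l2_span_def)
  have "(\<lambda>x. \<Sum>i\<in>I. c i *\<^sub>R \<psi> i x) \<in> L2 S" if "finite I" "I \<subseteq> {1..r}" for I
    using that
  proof (induction I rule: finite_induct)
    case empty
    then show ?case
      by (simp add: zero_in_L2)
  next
    case (insert k I)
    then have "\<psi> k \<in> L2 S" "(\<lambda>x. \<Sum>i\<in>I. c i *\<^sub>R \<psi> i x) \<in> L2 S"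
      using \<psi> by auto
    from L2_linear_combination[OF this, of "c k" 1] insert(1,2) show ?case
      by simp
  qed
  then have "(\<lambda>x. \<Sum>i = 1..r. c i *\<^sub>R \<psi> i x) \<in> L2 S"
    by simp
  then show ?thesis
    by (rule L2_AE[OF S _ c])
qed

text \<open>Makes the midpoint an admissible test function in Step 2; its coefficients are the
  averages.\<close>

lemma l2_span_midpoint:
  assumes "v \<in> l2_span S r \<psi>" "w \<in> l2_span S r \<psi>"
  shows "(\<lambda>x. (v x + w x) /\<^sub>R 2) \<in> l2_span S r \<psi>"
proof -
  obtain c d where "AE x in lebesgue_on S. v x = (\<Sum>i = 1..r. c i *\<^sub>R \<psi> i x)"
    "AE x in lebesgue_on S. w x = (\<Sum>i = 1..r. d i *\<^sub>R \<psi> i x)"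
    using assms by (auto simp: l2_span_def)
  then have "AE x in lebesgue_on S. (v x + w x) /\<^sub>R 2 = (\<Sum>i = 1..r. ((c i + d i) / 2) *\<^sub>R \<psi> i x)"
    by eventually_elim
       (simp add: scaleR_sum_right scaleR_add_left scaleR_add_right sum.distrib add_divide_distrib)
  then show ?thesis
    unfolding l2_span_def by (intro CollectI exI)
qed

section \<open>Energy estimates\<close>

text \<open>A real \<open>SUP\<close> dominates its members only once the quotients are known to be
  bounded above, which membership in \<open>Hminus1\<close> provides. Clearing the denominator then
  gives the estimate, except where the gradient norm vanishes.\<close>

lemma Hminus1_norm_bound:
  assumes F: "F \<in> Hminus1 \<Omega>" and v: "v \<in> velocity_space \<Omega>"
  shows "F v \<le> Hminus1_norm \<Omega> F * l2_norm \<Omega> (grad \<Omega> v)"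
proof -
  obtain C where C: "\<And>v. v \<in> velocity_space \<Omega> \<Longrightarrow> \<bar>F v\<bar> \<le> C * l2_norm \<Omega> (grad \<Omega> v)"
    using F unfolding Hminus1_def by blast
  \<comment> \<open>Nothing forces \<open>C\<close> to be nonnegative, and a quotient with
    denominator 0 has the value 0; \<open>max C 0\<close> dominates in either case.\<close>
  have "\<bar>F z\<bar> / l2_norm \<Omega> (grad \<Omega> z) \<le> max C 0" if "z \<in> velocity_space \<Omega>" for z
  proof -
    have g: "0 \<le> l2_norm \<Omega> (grad \<Omega> z)"
      by (rule l2_norm_nonneg)
    then have "\<bar>F z\<bar> \<le> max C 0 * l2_norm \<Omega> (grad \<Omega> z)"
      using C[OF that] mult_right_mono[OF max.cobounded1, of "l2_norm \<Omega> (grad \<Omega> z)" C 0]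
      by linarith
    then show ?thesis
      using g by (cases "l2_norm \<Omega> (grad \<Omega> z) = 0") (auto simp: divide_le_eq)
  qed
  then have "bdd_above ((\<lambda>v. \<bar>F v\<bar> / l2_norm \<Omega> (grad \<Omega> v)) ` velocity_space \<Omega>)"
    by (auto intro!: bdd_aboveI2)
  then have le: "\<bar>F v\<bar> / l2_norm \<Omega> (grad \<Omega> v) \<le> Hminus1_norm \<Omega> F"
    unfolding Hminus1_norm_def using v by (intro cSUP_upper)
  show ?thesis
  \<comment> \<open>For a vanishing gradient norm the quotient carries no information about
    \<open>F v\<close>; the bound with \<open>C\<close> itself then forces
    \<open>F v = 0\<close>.\<close>
  proof (cases "l2_norm \<Omega> (grad \<Omega> v) = 0")
    case True
    then show ?thesis
      using C[OF v] by simp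
  next
    case False
    then have "\<bar>F v\<bar> \<le> Hminus1_norm \<Omega> F * l2_norm \<Omega> (grad \<Omega> v)"
      using le l2_norm_nonneg[of \<Omega> "grad \<Omega> v"] by (simp add: divide_le_eq)
    then show ?thesis
      by simp
  qed
qed

text \<open>The explicit skew-symmetrization makes both terms the same number, so they cancel
  without integration by parts.\<close>

lemma trilinear_b_skew: "trilinear_b \<Omega> u v v = 0"
  by (simp add: trilinear_b_def)

lemma evolve_step_energy:
  assumes "\<nu> > 0" "\<Delta>t > 0"
    and L2: "u \<in> L2 \<Omega>" "w \<in> L2 \<Omega>" and w: "w \<in> velocity_space \<Omega>" and F: "F \<in> Hminus1 \<Omega>"
    and eq: "l2_inner \<Omega> (\<lambda>x. (w x - u x) /\<^sub>R \<Delta>t) w + trilinear_b \<Omega> w w w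
             + \<nu> * l2_inner \<Omega> (grad \<Omega> w) (grad \<Omega> w) = F w"
  shows "(l2_norm \<Omega> w)\<^sup>2 + (l2_norm \<Omega> (\<lambda>x. w x - u x))\<^sup>2 + \<nu> * \<Delta>t * (l2_norm \<Omega> (grad \<Omega> w))\<^sup>2
         \<le> (l2_norm \<Omega> u)\<^sup>2 + inverse \<nu> * (\<Delta>t * (Hminus1_norm \<Omega> F)\<^sup>2)"
proof -
  let ?g = "l2_norm \<Omega> (grad \<Omega> w)" and ?d = "Hminus1_norm \<Omega> F"
  have "l2_inner \<Omega> (\<lambda>x. w x - u x) w / \<Delta>t + \<nu> * ?g\<^sup>2 \<le> ?d * ?g"
    using eq Hminus1_norm_bound[OF F w]
    unfolding l2_inner_scaleR_left trilinear_b_skew power2_l2_norm by (simp add: field_simps)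
  \<comment> \<open>Multiplication by \<open>2 * \<Delta>t\<close> matches the factor 2 in the
    polarization identity.\<close>
  then have "2 * l2_inner \<Omega> (\<lambda>x. w x - u x) w + 2 * \<Delta>t * \<nu> * ?g\<^sup>2 \<le> \<Delta>t * (2 * ?d * ?g)"
    using \<open>\<Delta>t > 0\<close> by (simp add: field_simps)
  \<comment> \<open>Young's inequality weighted by \<open>\<nu>\<close>: one half of the viscous
    term \<open>2 * \<Delta>t * \<nu> * ?g\<^sup>2\<close> absorbs the gradient part of the forcing,
    the other half stays on the left, and the data receive the factor
    \<open>inverse \<nu>\<close>.\<close>
  moreover have "2 * ?d * ?g \<le> inverse \<nu> * ?d\<^sup>2 + \<nu> * ?g\<^sup>2"
  proof -
    have "0 \<le> inverse \<nu> * (?d - \<nu> * ?g)\<^sup>2"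
      using \<open>\<nu> > 0\<close> by simp
    also have "\<dots> = inverse \<nu> * ?d\<^sup>2 + \<nu> * ?g\<^sup>2 - 2 * ?d * ?g"
      using \<open>\<nu> > 0\<close> by (simp add: power2_eq_square field_simps)
    finally show ?thesis
      by simp
  qed
  then have "\<Delta>t * (2 * ?d * ?g) \<le> \<Delta>t * (inverse \<nu> * ?d\<^sup>2 + \<nu> * ?g\<^sup>2)"
    using \<open>\<Delta>t > 0\<close> by (intro mult_left_mono) auto
  ultimately show ?thesis
    unfolding l2_inner_polarization[OF L2] by (simp add: algebra_simps)
qed

text \<open>\<open>q\<close> stands for the gradient fluctuation of the midpoint. Testing with that
  same midpoint turns the eddy viscosity term into a square, so its dissipation is accounted for
  exactly.\<close>

lemma postprocess_step_energy:
  assumes "\<Delta>t > 0" and L2: "u \<in> L2 \<Omega>" "w \<in> L2 \<Omega>"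
    and eq: "l2_inner \<Omega> (\<lambda>x. (w x - u x) /\<^sub>R \<Delta>t) (\<lambda>x. (w x + u x) /\<^sub>R 2) =
             l2_inner \<Omega> (\<lambda>x. \<nu>\<^sub>T *\<^sub>R q x) q"
  shows "(l2_norm \<Omega> u)\<^sup>2 + 2 * \<nu>\<^sub>T * \<Delta>t * (l2_norm \<Omega> q)\<^sup>2 = (l2_norm \<Omega> w)\<^sup>2"
proof -
  have "l2_inner \<Omega> (\<lambda>x. w x - u x) (\<lambda>x. (w x + u x) /\<^sub>R 2) = \<nu>\<^sub>T * \<Delta>t * (l2_norm \<Omega> q)\<^sup>2"
    using eq \<open>\<Delta>t > 0\<close> unfolding l2_inner_scaleR_left power2_l2_norm
    by (simp add: field_simps)
  then show ?thesis
    using l2_inner_diff_midpoint[OF L2] by simp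
qed

text \<open>In the application \<open>a\<close> is the squared norm of \<open>u n\<close>,
  \<open>b\<close> the dissipation and \<open>c\<close> the forcing.\<close>

lemma telescoping_sum_le:
  fixes a :: "nat \<Rightarrow> real"
  assumes "\<And>n. n < M \<Longrightarrow> a (Suc n) + b n \<le> a n + c n"
  shows "a M + (\<Sum>n = 0..<M. b n) \<le> a 0 + (\<Sum>n = 0..<M. c n)"
  using assms
proof (induction M)
  case (Suc M)
  from Suc.IH[OF Suc.prems] Suc.prems[of M] show ?case
    by simp
qed simp

theorem lemma3p1:
  fixes \<Omega> :: "(real ^ 'n) set"
    and Xh :: "(real ^ 'n \<Rightarrow> real ^ 'n) set"
    and S \<psi> u w :: "nat \<Rightarrow> real ^ 'n \<Rightarrow> real ^ 'n"
    and u0 :: "real ^ 'n \<Rightarrow> real ^ 'n"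
    and f :: "real \<Rightarrow> (real ^ 'n \<Rightarrow> real ^ 'n) \<Rightarrow> real"
    and N r R M :: nat
    and \<nu> \<nu>\<^sub>T T \<Delta>t :: real
  assumes dim: "CARD('n) = 2 \<or> CARD('n) = 3"
    and domain: "polyhedral_domain \<Omega>"
    and viscosity: "\<nu> > 0" and eddy_viscosity: "\<nu>\<^sub>T > 0"
    and time: "T > 0" "M > 0" "\<Delta>t = T / real M"
    and forcing: "f \<in> L2_Hminus1 \<Omega> T"
    and forcing_values: "\<forall>n\<le>M. f (real n * \<Delta>t) \<in> Hminus1 \<Omega>"
    and fe_space: "conforming_fe_space \<Omega> Xh"
    and snapshots: "\<forall>j\<in>{1..N}. S j \<in> Xh"
    and pod: "pod_basis \<Omega> N S r \<psi>"
    and basis_in_X: "\<forall>i\<in>{1..r}. \<psi> i \<in> velocity_space \<Omega>"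
    and R_less: "R < r"
    and initial_velocity: "u0 \<in> L2 \<Omega>"
    and initial_u: "is_l2_proj \<Omega> (l2_span \<Omega> r \<psi>) u0 (u 0)"
    and initial_w: "AE x in lebesgue_on \<Omega>. w 0 x = u 0 x"
    and step1: "\<forall>n<M. w (Suc n) \<in> l2_span \<Omega> r \<psi> \<and>
       (\<forall>\<phi>\<in>l2_span \<Omega> r \<psi>.
          l2_inner \<Omega> (\<lambda>x. (w (Suc n) x - u n x) /\<^sub>R \<Delta>t) \<phi>
          + trilinear_b \<Omega> (w (Suc n)) (w (Suc n)) \<phi>
          + \<nu> * l2_inner \<Omega> (grad \<Omega> (w (Suc n))) (grad \<Omega> \<phi>)
          = f (real (Suc n) * \<Delta>t) \<phi>)"
    and step2: "\<forall>n<M. u (Suc n) \<in> l2_span \<Omega> r \<psi> \<and>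
       (\<forall>\<phi>\<in>l2_span \<Omega> r \<psi>.
          l2_inner \<Omega> (\<lambda>x. (w (Suc n) x - u (Suc n) x) /\<^sub>R \<Delta>t) \<phi>
          = l2_inner \<Omega>
              (\<lambda>x. \<nu>\<^sub>T *\<^sub>R grad_fluctuation \<Omega> \<psi> R (\<lambda>y. (w (Suc n) y + u (Suc n) y) /\<^sub>R 2) x)
              (grad_fluctuation \<Omega> \<psi> R \<phi>))"
  shows "(l2_norm \<Omega> (u M))\<^sup>2
      + (\<Sum>n = 0..<M.
           2 * \<nu>\<^sub>T * \<Delta>t *
             (l2_norm \<Omega> (grad_fluctuation \<Omega> \<psi> R (\<lambda>x. (w (Suc n) x + u (Suc n) x) /\<^sub>R 2)))\<^sup>2
           + (l2_norm \<Omega> (\<lambda>x. w (Suc n) x - u n x))\<^sup>2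
           + \<nu> * \<Delta>t * (l2_norm \<Omega> (grad \<Omega> (w (Suc n))))\<^sup>2)
    \<le> (l2_norm \<Omega> (u 0))\<^sup>2 + inverse \<nu> * (discrete_dual_norm \<Omega> \<Delta>t M f)\<^sup>2"
proof -
  have \<Omega>: "bounded \<Omega>" "\<Omega> \<in> sets lebesgue"
    using domain by (auto simp: polyhedral_domain_def)
  have \<Delta>t: "\<Delta>t > 0"
    using time by simp
  have \<psi>: "\<forall>i\<in>{1..r}. \<psi> i \<in> L2 \<Omega>"
    using pod by (auto simp: pod_basis_def l2_orthonormal_def)
  \<comment> \<open>Level 0 lies in the span as a projection onto it, every later level by Step
    2.\<close>
  have uX: "u n \<in> l2_span \<Omega> r \<psi>" if "n \<le> M" for n
    using that initial_u step2 by (cases n) (auto simp: is_l2_proj_def)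
  have uL2: "u n \<in> L2 \<Omega>" if "n \<le> M" for n
    by (rule L2_l2_span[OF \<Omega>(2) \<psi> uX[OF that]])
  let ?q = "\<lambda>n. grad_fluctuation \<Omega> \<psi> R (\<lambda>x. (w (Suc n) x + u (Suc n) x) /\<^sub>R 2)"
  let ?d = "\<lambda>n. Hminus1_norm \<Omega> (f (real n * \<Delta>t))"
  have step: "(l2_norm \<Omega> (u (Suc n)))\<^sup>2 +
      (2 * \<nu>\<^sub>T * \<Delta>t * (l2_norm \<Omega> (?q n))\<^sup>2
       + (l2_norm \<Omega> (\<lambda>x. w (Suc n) x - u n x))\<^sup>2
       + \<nu> * \<Delta>t * (l2_norm \<Omega> (grad \<Omega> (w (Suc n))))\<^sup>2)
      \<le> (l2_norm \<Omega> (u n))\<^sup>2 + inverse \<nu> * (\<Delta>t * (?d (Suc n))\<^sup>2)" if n: "n < M" for n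
  proof -
    have wX: "w (Suc n) \<in> l2_span \<Omega> r \<psi>"
      using step1 n by blast
    have wL2: "w (Suc n) \<in> L2 \<Omega>"
      by (rule L2_l2_span[OF \<Omega>(2) \<psi> wX])
    have "(l2_norm \<Omega> (w (Suc n)))\<^sup>2 + (l2_norm \<Omega> (\<lambda>x. w (Suc n) x - u n x))\<^sup>2
          + \<nu> * \<Delta>t * (l2_norm \<Omega> (grad \<Omega> (w (Suc n))))\<^sup>2
          \<le> (l2_norm \<Omega> (u n))\<^sup>2 + inverse \<nu> * (\<Delta>t * (?d (Suc n))\<^sup>2)"
    proof (rule evolve_step_energy[OF viscosity \<Delta>t uL2 wL2])
      show "w (Suc n) \<in> velocity_space \<Omega>"
        by (rule velocity_space_l2_span[OF \<Omega> basis_in_X wX])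
      show "f (real (Suc n) * \<Delta>t) \<in> Hminus1 \<Omega>"
        using forcing_values n Suc_leI by blast
    \<comment> \<open>What remains is \<open>n \<le> M\<close>, demanded by \<open>uL2\<close>, and
      Step 1 tested with \<open>w (Suc n)\<close> itself.\<close>
    qed (use step1 n wX in auto)
    moreover have "(l2_norm \<Omega> (u (Suc n)))\<^sup>2 + 2 * \<nu>\<^sub>T * \<Delta>t * (l2_norm \<Omega> (?q n))\<^sup>2
        = (l2_norm \<Omega> (w (Suc n)))\<^sup>2"
    proof (rule postprocess_step_energy[OF \<Delta>t uL2 wL2])
      have "(\<lambda>x. (w (Suc n) x + u (Suc n) x) /\<^sub>R 2) \<in> l2_span \<Omega> r \<psi>"
        using wX uX n by (intro l2_span_midpoint) auto
      then show "l2_inner \<Omega> (\<lambda>x. (w (Suc n) x - u (Suc n) x) /\<^sub>R \<Delta>t)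
          (\<lambda>x. (w (Suc n) x + u (Suc n) x) /\<^sub>R 2) = l2_inner \<Omega> (\<lambda>x. \<nu>\<^sub>T *\<^sub>R ?q n x) (?q n)"
        using step2 n by blast
    qed (use n in auto)
    \<comment> \<open>The energy of the intermediate velocity \<open>w (Suc n)\<close> occurs on
      opposite sides of the two relations and cancels.\<close>
    ultimately show ?thesis
      by linarith
  qed
  \<comment> \<open>The scheme samples the forcing at levels 1 to \<open>M\<close>, whereas the
    discrete norm also counts level 0; that extra square is nonnegative.\<close>
  have "(\<Sum>n = 0..<M. (?d (Suc n))\<^sup>2) \<le> (\<Sum>n = 0..M. (?d n)\<^sup>2)"
    unfolding atLeast0AtMost lessThan_Suc_atMost[symmetric] sum.lessThan_Suc_shift atLeast0LessThan
    by simp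
  then have "inverse \<nu> * (\<Delta>t * (\<Sum>n = 0..<M. (?d (Suc n))\<^sup>2)) \<le> inverse \<nu> * (\<Delta>t * (\<Sum>n = 0..M. (?d n)\<^sup>2))"
    using viscosity \<Delta>t by (intro mult_left_mono) auto
  also have "\<dots> = inverse \<nu> * (discrete_dual_norm \<Omega> \<Delta>t M f)\<^sup>2"
    using \<Delta>t by (simp add: discrete_dual_norm_def sum_nonneg)
  finally have forcing_sum: "inverse \<nu> * (\<Delta>t * (\<Sum>n = 0..<M. (?d (Suc n))\<^sup>2))
      \<le> inverse \<nu> * (discrete_dual_norm \<Omega> \<Delta>t M f)\<^sup>2" .
  \<comment> \<open>Reversed distributivity pulls \<open>inverse \<nu>\<close> and
    \<open>\<Delta>t\<close> out of the telescoped forcing sum, which gives it the form in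
    \<open>forcing_sum\<close>.\<close>
  show ?thesis
    by (rule order_trans[OF telescoping_sum_le[where a = "\<lambda>n. (l2_norm \<Omega> (u n))\<^sup>2", OF step]])
       (use forcing_sum in \<open>simp_all flip: sum_distrib_left\<close>)
qed

end
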